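(* Let $\mathcal{X}$ be a complex Banach space and let $\mathcal{A} \subseteq \mathcal{B}(\mathcal{X})$ be a norm-closed algebra of operators. Suppose that $\mathcal{Y}$ is a closed, topologically complemented half-space of $\mathcal{X}$ and that for each $T \in \mathcal{A}$ there exists a finite-dimensional subspace $\mathcal{M}_T$ of $\mathcal{X}$ such that $T\mathcal{Y} \subseteq \mathcal{Y} + \mathcal{M}_T$. Then $\mathcal{A}$ admits an invariant half-space $\mathcal{L}$ (that is, $T\mathcal{L} \subseteq \mathcal{L}$ for all $T \in \mathcal{A}$). Moreover, there exists a finite-dimensional subspace $\mathcal{F}$ of $\mathcal{X}$ such that $\mathcal{L}$ is a finite-codimensional subspace of $\mathcal{Y} + \mathcal{F}$.
   Context: $\mathcal{B}(\mathcal{X})$ is the algebra of all bounded linear operators on $\mathcal{X}$. All subspaces of Banach spaces are assumed to be norm-closed. A subspace $\mathcal{Y}$ of $\mathcal{X}$ is a half-space if $\dim \mathcal{Y} = \dim(\mathcal{X}/\mathcal{Y}) = \infty$. *)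

theory Defs
  imports "HOL-Analysis.Analysis" "HOL-Library.Set_Algebras"
begin

text \<open>
  HOL-Analysis only knows real Banach spaces. A complex Banach space is a real one carrying a
  compatible complex scalar multiplication for which the norm is absolutely homogeneous.
\<close>

class complex_banach = banach +
  fixes scaleC :: "complex \<Rightarrow> 'a \<Rightarrow> 'a"  (infixr \<open>*\<^sub>C\<close> 75)
  assumes scaleC_add_right: "c *\<^sub>C (x + y) = c *\<^sub>C x + c *\<^sub>C y"
    and scaleC_add_left: "(c + d) *\<^sub>C x = c *\<^sub>C x + d *\<^sub>C x"
    and scaleC_scaleC: "c *\<^sub>C d *\<^sub>C x = (c * d) *\<^sub>C x"
    and scaleC_of_real: "complex_of_real r *\<^sub>C x = r *\<^sub>R x"
    and norm_scaleC: "norm (c *\<^sub>C x) = cmod c * norm x"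

global_interpretation complex_vector:
  vector_space "scaleC :: complex \<Rightarrow> 'a \<Rightarrow> 'a::complex_banach"
  defines csubspace = complex_vector.subspace
    and cspan = complex_vector.span
proof
  show "1 *\<^sub>C x = x" for x :: 'a
    using scaleC_of_real[of 1 x] by simp
qed (rule scaleC_add_right scaleC_add_left scaleC_scaleC)+

lemma bounded_linear_scaleC_right: "bounded_linear (\<lambda>x::'a::complex_banach. c *\<^sub>C x)"
proof
  show "\<exists>K. \<forall>x::'a. norm (c *\<^sub>C x) \<le> norm x * K"
    by (rule exI[of _ "cmod c"]) (simp add: norm_scaleC)
  show "c *\<^sub>C r *\<^sub>R x = r *\<^sub>R c *\<^sub>C x" for r and x :: 'a
    by (simp add: scaleC_of_real[symmetric] scaleC_scaleC mult.commute)
qed (rule scaleC_add_right)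

text \<open>
  Pointwise complex multiples make bounded (real-linear) operators a complex Banach space, so that
  the notions of subspace and closedness below apply to sets of operators as well.
\<close>

instantiation blinfun :: (real_normed_vector, complex_banach) complex_banach
begin

lift_definition scaleC_blinfun :: "complex \<Rightarrow> ('a \<Rightarrow>\<^sub>L 'b) \<Rightarrow> 'a \<Rightarrow>\<^sub>L 'b"
  is "\<lambda>c T x. c *\<^sub>C T x"
  by (rule bounded_linear_compose[OF bounded_linear_scaleC_right])

instance
proof
  fix c d :: complex and r :: real and S T :: "'a \<Rightarrow>\<^sub>L 'b"
  show "c *\<^sub>C (S + T) = c *\<^sub>C S + c *\<^sub>C T"
    by transfer (simp add: scaleC_add_right)
  show "(c + d) *\<^sub>C T = c *\<^sub>C T + d *\<^sub>C T"
    by transfer (simp add: scaleC_add_left)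
  show mult: "c *\<^sub>C d *\<^sub>C T = (c * d) *\<^sub>C T" for c d and T :: "'a \<Rightarrow>\<^sub>L 'b"
    by transfer (simp add: scaleC_scaleC)
  show of_real: "complex_of_real r *\<^sub>C T = r *\<^sub>R T" for r and T :: "'a \<Rightarrow>\<^sub>L 'b"
    by transfer (simp add: scaleC_of_real)
  have le: "norm (c *\<^sub>C T) \<le> cmod c * norm T" for c and T :: "'a \<Rightarrow>\<^sub>L 'b"
    by (rule norm_blinfun_bound)
      (simp_all add: scaleC_blinfun.rep_eq norm_scaleC mult.assoc mult_left_mono norm_blinfun)
  show "norm (c *\<^sub>C T) = cmod c * norm T"
  proof (cases "c = 0")
    case True
    then show ?thesis using le[of 0 T] by simp
  next
    case False
    have "T = inverse c *\<^sub>C c *\<^sub>C T"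
      using False of_real[of 1 T] by (simp add: mult)
    then have "norm T \<le> inverse (cmod c) * norm (c *\<^sub>C T)"
      using le[of "inverse c" "c *\<^sub>C T"] by (simp add: norm_inverse)
    then have "cmod c * norm T \<le> norm (c *\<^sub>C T)"
      using False by (simp add: field_simps)
    with le show ?thesis by (rule antisym)
  qed
qed

end

definition complex_operators :: "('a::complex_banach \<Rightarrow>\<^sub>L 'a) set" where
  "complex_operators = {T. \<forall>c x. blinfun_apply T (c *\<^sub>C x) = c *\<^sub>C blinfun_apply T x}"

definition closed_csubspace :: "'a::complex_banach set \<Rightarrow> bool" where
  "closed_csubspace Y \<longleftrightarrow> csubspace Y \<and> closed Y"

text \<open>Not required to contain the identity operator.\<close>

definition closed_operator_algebra :: "('a::complex_banach \<Rightarrow>\<^sub>L 'a) set \<Rightarrow> bool" where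
  "closed_operator_algebra \<A> \<longleftrightarrow>
    \<A> \<subseteq> complex_operators \<and> closed_csubspace \<A> \<and> (\<forall>S\<in>\<A>. \<forall>T\<in>\<A>. S o\<^sub>L T \<in> \<A>)"

definition finite_cdim :: "'a::complex_banach set \<Rightarrow> bool" where
  "finite_cdim V \<longleftrightarrow> (\<exists>B. finite B \<and> B \<subseteq> V \<and> V \<subseteq> cspan B)"

text \<open>
  For subspaces \<open>V \<subseteq> W\<close>: the quotient \<open>W / V\<close> is finite-dimensional, i.e. the cosets \<open>b + V\<close> with
  \<open>b\<close> in some finite \<open>B \<subseteq> W\<close> span it (a linear combination of these cosets is the coset of
  the corresponding linear combination of elements of \<open>B\<close>).
\<close>

definition finite_cdim_quotient :: "'a::complex_banach set \<Rightarrow> 'a set \<Rightarrow> bool" where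
  "finite_cdim_quotient W V \<longleftrightarrow>
    (\<exists>B. finite B \<and> B \<subseteq> W \<and> (\<forall>w\<in>W. \<exists>b\<in>cspan B. w +o V = b +o V))"

definition half_space :: "'a::complex_banach set \<Rightarrow> bool" where
  "half_space Y \<longleftrightarrow>
    closed_csubspace Y \<and> \<not> finite_cdim Y \<and> \<not> finite_cdim_quotient UNIV Y"

definition topologically_complemented :: "'a::complex_banach set \<Rightarrow> bool" where
  "topologically_complemented Y \<longleftrightarrow>
    closed_csubspace Y \<and> (\<exists>Z. closed_csubspace Z \<and> Y \<inter> Z = {0} \<and> Y + Z = UNIV)"

definition invariant_under :: "('a::complex_banach \<Rightarrow>\<^sub>L 'a) set \<Rightarrow> 'a set \<Rightarrow> bool" where
  "invariant_under \<A> L \<longleftrightarrow> (\<forall>T\<in>\<A>. blinfun_apply T ` L \<subseteq> L)"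

end

theory Submission
  imports Defs
begin

text \<open>
  For \<open>T \<in> \<A>\<close> let \<open>\<pi> T\<close> be the finite-rank operator \<open>Y \<rightarrow> X / Y\<close> induced by \<open>T\<close>. Having rank at
  least \<open>n\<close> is an open condition, so Baire's theorem in the complete space \<open>\<A>\<close> yields an open set
  on which the rank is bounded. Choose \<open>T\<^sub>0\<close> of maximal rank there, with \<open>y\<^sub>1, \<dots>, y\<^sub>n\<close> in \<open>Y\<close>
  mapped to a basis of the range, and let \<open>V\<close> be the kernel of \<open>\<pi> T\<^sub>0\<close>, of finite codimension in
  \<open>Y\<close>. If \<open>T \<in> \<A>\<close> moved some \<open>z \<in> V\<close> out of \<open>Y + F\<close> with \<open>F = span (T\<^sub>0 y\<^sub>i)\<close>, then \<open>T\<^sub>0 + r T\<close>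
  would have larger rank for small \<open>r \<noteq> 0\<close>, as seen on \<open>y\<^sub>1, \<dots>, y\<^sub>n, z\<close>. Hence every \<open>T \<in> \<A>\<close>
  maps \<open>V\<close> into \<open>Y + F\<close>, and the closed span \<open>L\<close> of \<open>V \<union> \<A> V\<close> is invariant because \<open>\<A>\<close> is
  closed under products, while \<open>V \<subseteq> L \<subseteq> Y + F\<close>.
\<close>

section \<open>Complex subspaces, finite-dimensional extensions and quotients\<close>

lemma csubspace_set_plus:
  assumes "csubspace U" "csubspace V"
  shows "csubspace (U + V)"
proof -
  have "U + V = {x + y |x y. x \<in> U \<and> y \<in> V}"
    by (auto simp: set_plus_def)
  then show ?thesis
    using complex_vector.subspace_sums[OF assms] by simp
qed

lemma csubspace_vimage:
  assumes "T \<in> complex_operators" "csubspace V"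
  shows "csubspace {x. blinfun_apply T x \<in> V}"
  using assms unfolding complex_vector.subspace_def complex_operators_def
  by (simp add: blinfun.add_right blinfun.zero_right)

lemma csubspace_imp_subspace: "csubspace V \<Longrightarrow> subspace V"
  unfolding complex_vector.subspace_def subspace_def
  by (metis scaleC_of_real)

lemma closed_csubspace_zero: "closed_csubspace {0}"
  by (simp add: closed_csubspace_def complex_vector.subspace_single_0)

text \<open>A ball of radius \<open>d\<close> around \<open>v\<close> misses the closed set
  \<open>Y\<close>; dividing \<open>a *\<^sub>C v + y\<close> by a nonzero \<open>a\<close> reduces
  the claim to this. It makes the coefficient of \<open>v\<close> depend continuously on the
  vector.\<close>

lemma scaleC_distance_bound:
  assumes "closed_csubspace Y" "v \<notin> Y"
  obtains d where "d > 0" "\<And>a y. y \<in> Y \<Longrightarrow> d * cmod a \<le> norm (a *\<^sub>C v + y)"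
proof -
  from assms have "open (- Y)" "v \<in> - Y"
    by (auto simp: closed_csubspace_def)
  then obtain d where d: "d > 0" "ball v d \<subseteq> - Y"
    by (meson openE)
  have "d * cmod a \<le> norm (a *\<^sub>C v + y)" if "y \<in> Y" for a y
  proof (cases "a = 0")
    case False
    have "- (inverse a *\<^sub>C y) \<in> Y"
      using assms that
      by (simp add: closed_csubspace_def complex_vector.subspace_neg complex_vector.subspace_scale)
    with d have "\<not> dist v (- (inverse a *\<^sub>C y)) < d"
      by auto
    then have "d \<le> norm (v + inverse a *\<^sub>C y)"
      by (simp add: dist_norm)
    then have "d * cmod a \<le> norm (a *\<^sub>C (v + inverse a *\<^sub>C y))"
      by (simp add: norm_scaleC mult.commute[of d] mult_left_mono)
    then show ?thesis
      using False by (simp add: scaleC_add_right scaleC_scaleC)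
  qed simp
  with d(1) that show thesis by blast
qed

text \<open>If \<open>v\<close> is outside \<open>Y\<close>, the distance bound turns a convergent
  sequence of sums into a Cauchy sequence of coefficients of \<open>v\<close>. These converge, hence
  so do the components in \<open>Y\<close>, whose limit stays in the closed set
  \<open>Y\<close>.\<close>

lemma closed_csubspace_plus_cspan_singleton:
  assumes Y: "closed_csubspace Y"
  shows "closed_csubspace (Y + cspan {v})"
proof (cases "v \<in> Y")
  case True
  have "Y + cspan {v} = Y"
  proof
    have "cspan {v} \<subseteq> Y"
      using True Y by (intro complex_vector.span_minimal) (auto simp: closed_csubspace_def)
    then show "Y + cspan {v} \<subseteq> Y"
      using Y by (auto simp: closed_csubspace_def set_plus_def complex_vector.subspace_add)
    show "Y \<subseteq> Y + cspan {v}"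
      using complex_vector.span_zero by (force simp: set_plus_def)
  qed
  with Y show ?thesis by simp
next
  case False
  obtain d where d: "d > 0" "\<And>a y. y \<in> Y \<Longrightarrow> d * cmod a \<le> norm (a *\<^sub>C v + y)"
    using scaleC_distance_bound[OF Y False] by blast
  have sub: "csubspace Y" and cl: "closed Y"
    using Y by (auto simp: closed_csubspace_def)
  have "l \<in> Y + cspan {v}" if x: "\<And>k. x k \<in> Y + cspan {v}" and lim: "x \<longlonglongrightarrow> l" for x l
  proof -
    have "\<forall>k. \<exists>a y. y \<in> Y \<and> x k = a *\<^sub>C v + y"
      using x by (fastforce simp: set_plus_def complex_vector.span_singleton add.commute)
    then obtain a y where y: "\<And>k. y k \<in> Y" and xk: "\<And>k. x k = a k *\<^sub>C v + y k"
      by metis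
    have bound: "d * dist (a i) (a j) \<le> dist (x i) (x j)" for i j
    proof -
      have "x i - x j = (a i - a j) *\<^sub>C v + (y i - y j)"
        by (simp add: xk complex_vector.scale_left_diff_distrib)
      then show ?thesis
        using d(2)[OF complex_vector.subspace_diff[OF sub y y]] by (simp add: dist_norm)
    qed
    have "Cauchy a"
    proof (rule metric_CauchyI)
      fix e :: real assume "e > 0"
      with d(1) lim obtain M where "\<forall>i\<ge>M. \<forall>j\<ge>M. dist (x i) (x j) < d * e"
        using LIMSEQ_imp_Cauchy[OF lim] unfolding Cauchy_def by (meson mult_pos_pos)
      then have "\<forall>i\<ge>M. \<forall>j\<ge>M. d * dist (a i) (a j) < d * e"
        using bound by (meson order_le_less_trans)
      then show "\<exists>M. \<forall>i\<ge>M. \<forall>j\<ge>M. dist (a i) (a j) < e"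
        using d(1) by auto
    qed
    then obtain b where b: "a \<longlonglongrightarrow> b"
      using Cauchy_convergent convergent_def by blast
    have "(\<lambda>k. a k *\<^sub>C v) \<longlonglongrightarrow> b *\<^sub>C v"
    proof (rule Lim_null_comparison[THEN LIM_zero_cancel])
      show "\<forall>\<^sub>F k in sequentially. norm (a k *\<^sub>C v - b *\<^sub>C v) \<le> cmod (a k - b) * norm v"
        by (simp add: norm_scaleC flip: complex_vector.scale_left_diff_distrib)
      show "(\<lambda>k. cmod (a k - b) * norm v) \<longlonglongrightarrow> 0"
        using tendsto_mult[OF tendsto_norm[OF LIM_zero[OF b]] tendsto_const[of "norm v"]] by simp
    qed
    then have "(\<lambda>k. x k - a k *\<^sub>C v) \<longlonglongrightarrow> l - b *\<^sub>C v"
      by (intro tendsto_diff lim)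
    then have "y \<longlonglongrightarrow> l - b *\<^sub>C v"
      by (simp add: xk)
    then have "l - b *\<^sub>C v \<in> Y"
      using cl y closed_sequentially by blast
    then have "(l - b *\<^sub>C v) + b *\<^sub>C v \<in> Y + cspan {v}"
      by (intro set_plus_intro) (auto simp: complex_vector.span_singleton)
    then show ?thesis by simp
  qed
  then have "closed (Y + cspan {v})"
    by (auto simp: closed_sequential_limits)
  then show ?thesis
    using sub by (simp add: closed_csubspace_def csubspace_set_plus complex_vector.subspace_span)
qed

lemma cspan_Un: "cspan (A \<union> B) = cspan A + cspan B"
  unfolding complex_vector.span_Un set_plus_def by blast

lemma closed_csubspace_plus_cspan:
  assumes "finite B" "closed_csubspace Y"
  shows "closed_csubspace (Y + cspan B)"
  using assms
proof (induction B)
  case empty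
  then show ?case by simp
next
  case (insert v B)
  have "Y + cspan (insert v B) = (Y + cspan B) + cspan {v}"
    using cspan_Un[of B "{v}"] by (simp add: add.assoc)
  with insert show ?case
    by (simp add: closed_csubspace_plus_cspan_singleton)
qed

lemma closed_csubspace_cspan: "finite B \<Longrightarrow> closed_csubspace (cspan B)"
  using closed_csubspace_plus_cspan[OF _ closed_csubspace_zero, of B] by simp

lemma finite_cdim_cspan: "finite B \<Longrightarrow> finite_cdim (cspan B)"
  unfolding finite_cdim_def using complex_vector.span_superset by blast

text \<open>\<open>finite_cdim\<close> asks for spanning vectors inside the set itself, and
  \<open>B\<close> need not lie in \<open>V\<close>. A maximal independent subset of
  \<open>V\<close> does, and its independence within \<open>cspan B\<close> makes it finite.\<close>

lemma finite_cdim_subset: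
  assumes "V \<subseteq> cspan B" "finite B"
  shows "finite_cdim V"
proof -
  obtain C where C: "C \<subseteq> V" "complex_vector.independent C" "V \<subseteq> cspan C"
    using complex_vector.maximal_independent_subset .
  moreover have "finite C"
    using complex_vector.independent_span_bound[OF assms(2) C(2)] C(1) assms(1) by blast
  ultimately show ?thesis
    unfolding finite_cdim_def by blast
qed

text \<open>Cosets of \<open>w\<close> and \<open>b\<close> agree exactly when \<open>w - b\<close>
  lies in \<open>V\<close>; this trades cosets for sums of subspaces, which are easier to
  compare.\<close>

lemma finite_cdim_quotient_iff:
  assumes "csubspace V"
  shows "finite_cdim_quotient W V \<longleftrightarrow> (\<exists>B. finite B \<and> B \<subseteq> W \<and> W \<subseteq> V + cspan B)"
proof -
  have coset: "w +o V = b +o V \<longleftrightarrow> w - b \<in> V" for w b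
  proof
    assume "w +o V = b +o V"
    moreover have "w + 0 \<in> w +o V"
      using complex_vector.subspace_0[OF assms] by (rule set_plus_intro2)
    ultimately show "w - b \<in> V"
      by (auto simp: elt_set_plus_def)
  next
    assume wb: "w - b \<in> V"
    have "x - w \<in> V \<longleftrightarrow> x - b \<in> V" for x
      using complex_vector.subspace_add[OF assms wb, of "x - w"]
        complex_vector.subspace_diff[OF assms _ wb, of "x - b"] by auto
    then show "w +o V = b +o V"
      by (auto simp: set_minus_plus[symmetric])
  qed
  have "(\<exists>b\<in>cspan B. w +o V = b +o V) \<longleftrightarrow> w \<in> V + cspan B" for w B
  proof
    assume "\<exists>b\<in>cspan B. w +o V = b +o V"
    then obtain b where "b \<in> cspan B" "w - b \<in> V"
      using coset by blast
    then have "(w - b) + b \<in> V + cspan B"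
      by (intro set_plus_intro)
    then show "w \<in> V + cspan B" by simp
  next
    assume "w \<in> V + cspan B"
    then obtain x b where "w = x + b" "x \<in> V" "b \<in> cspan B"
      by (rule set_plus_elim)
    then show "\<exists>b\<in>cspan B. w +o V = b +o V"
      using coset[of w b] by auto
  qed
  then show ?thesis
    unfolding finite_cdim_quotient_def by (simp add: subset_eq)
qed

text \<open>Coefficients are indexed by positions rather than by vectors, so repeated values of
  \<open>v\<close> do no harm and the sums match those in \<open>indep_mod\<close>.\<close>

lemma cspan_image_lessThan:
  "cspan (v ` {..<n::nat}) = range (\<lambda>a. \<Sum>i<n. a i *\<^sub>C v i)"
proof
  have "v j \<in> range (\<lambda>a. \<Sum>i<n. a i *\<^sub>C v i)" if "j < n" for j
  proof (rule range_eqI)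
    show "v j = (\<Sum>i<n. (if i = j then 1 else 0) *\<^sub>C v i)"
      using that by (simp add: if_distrib[of "\<lambda>c. c *\<^sub>C _"] cong: if_cong)
  qed
  moreover have "csubspace (range (\<lambda>a. \<Sum>i<n. a i *\<^sub>C v i))"
    unfolding complex_vector.subspace_def
  proof (intro conjI ballI allI)
    show "0 \<in> range (\<lambda>a. \<Sum>i<n. a i *\<^sub>C v i)"
      by (rule range_eqI[of _ _ "\<lambda>_. 0"]) simp
  next
    fix x y assume "x \<in> range (\<lambda>a. \<Sum>i<n. a i *\<^sub>C v i)" "y \<in> range (\<lambda>a. \<Sum>i<n. a i *\<^sub>C v i)"
    then obtain a b where "x = (\<Sum>i<n. a i *\<^sub>C v i)" "y = (\<Sum>i<n. b i *\<^sub>C v i)"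
      by blast
    then show "x + y \<in> range (\<lambda>a. \<Sum>i<n. a i *\<^sub>C v i)"
      by (intro range_eqI[of _ _ "\<lambda>i. a i + b i"]) (simp add: scaleC_add_left sum.distrib)
  next
    fix c x assume "x \<in> range (\<lambda>a. \<Sum>i<n. a i *\<^sub>C v i)"
    then obtain a where "x = (\<Sum>i<n. a i *\<^sub>C v i)"
      by blast
    then show "c *\<^sub>C x \<in> range (\<lambda>a. \<Sum>i<n. a i *\<^sub>C v i)"
      by (intro range_eqI[of _ _ "\<lambda>i. c * a i"])
        (simp add: complex_vector.scale_sum_right scaleC_scaleC)
  qed
  ultimately show "cspan (v ` {..<n}) \<subseteq> range (\<lambda>a. \<Sum>i<n. a i *\<^sub>C v i)"
    by (intro complex_vector.span_minimal) auto
  show "range (\<lambda>a. \<Sum>i<n. a i *\<^sub>C v i) \<subseteq> cspan (v ` {..<n})"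
    by (intro image_subsetI complex_vector.span_sum complex_vector.span_scale
        complex_vector.span_base) auto
qed

section \<open>Quantitative linear independence modulo a closed subspace\<close>

text \<open>
  For closed \<open>Y\<close> this is linear independence of the cosets \<open>v i + Y\<close> with \<open>i < n\<close>, see
  \<open>indep_mod_Suc\<close>; the uniform lower bound makes it evidently stable under perturbations.
\<close>

definition indep_mod :: "'a::complex_banach set \<Rightarrow> nat \<Rightarrow> (nat \<Rightarrow> 'a) \<Rightarrow> bool" where
  "indep_mod Y n v \<longleftrightarrow>
    (\<exists>c>0. \<forall>a. \<forall>y\<in>Y. c * (\<Sum>i<n. cmod (a i)) \<le> norm ((\<Sum>i<n. a i *\<^sub>C v i) + y))"

lemma indep_mod_0: "indep_mod Y 0 v"
  unfolding indep_mod_def by (auto intro: exI[of _ 1])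

lemma indep_mod_cong: "(\<And>i. i < n \<Longrightarrow> v i = w i) \<Longrightarrow> indep_mod Y n v \<longleftrightarrow> indep_mod Y n w"
  by (simp add: indep_mod_def)

lemma indep_mod_Suc:
  assumes Y: "closed_csubspace Y"
  shows "indep_mod Y (Suc n) v \<longleftrightarrow> indep_mod Y n v \<and> v n \<notin> Y + cspan (v ` {..<n})"
proof (intro iffI conjI)
  assume "indep_mod Y (Suc n) v"
  then obtain c where c: "c > 0" and
    bound: "\<And>a y. y \<in> Y \<Longrightarrow>
      c * (\<Sum>i<Suc n. cmod (a i)) \<le> norm ((\<Sum>i<Suc n. a i *\<^sub>C v i) + y)"
    unfolding indep_mod_def by blast
  have "c * (\<Sum>i<n. cmod (a i)) \<le> norm ((\<Sum>i<n. a i *\<^sub>C v i) + y)" if "y \<in> Y" for a y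
    using bound[OF that, of "a(n := 0)"] by simp
  with c show "indep_mod Y n v"
    unfolding indep_mod_def by blast
  show "v n \<notin> Y + cspan (v ` {..<n})"
  proof
    assume "v n \<in> Y + cspan (v ` {..<n})"
    then obtain y a where y: "y \<in> Y" and vn: "v n = y + (\<Sum>i<n. a i *\<^sub>C v i)"
      by (auto simp: set_plus_def cspan_image_lessThan)
    \<comment> \<open>The last coefficient \<open>- 1\<close> cancels \<open>v n\<close>, so the
      vector whose norm is bounded below is 0, although its coefficients are not all 0.\<close>
    have "c * (\<Sum>i<Suc n. cmod ((a(n := - 1)) i)) \<le> 0"
      using bound[OF y, of "a(n := - 1)"] by (simp add: vn)
    moreover have "0 \<le> (\<Sum>i<n. cmod (a i))"
      by (simp add: sum_nonneg)
    ultimately show False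
      using c by (simp add: mult_le_0_iff)
  qed
next
  assume "indep_mod Y n v \<and> v n \<notin> Y + cspan (v ` {..<n})"
  then obtain c where c: "c > 0" and
    bound: "\<And>a y. y \<in> Y \<Longrightarrow>
      c * (\<Sum>i<n. cmod (a i)) \<le> norm ((\<Sum>i<n. a i *\<^sub>C v i) + y)"
    and vn: "v n \<notin> Y + cspan (v ` {..<n})"
    unfolding indep_mod_def by blast
  obtain d where d: "d > 0" and
    dist: "\<And>b z. z \<in> Y + cspan (v ` {..<n}) \<Longrightarrow> d * cmod b \<le> norm (b *\<^sub>C v n + z)"
    using scaleC_distance_bound[OF closed_csubspace_plus_cspan[OF _ Y] vn] by blast
  \<comment> \<open>With \<open>N\<close> the norm of the full combination plus \<open>y\<close>,
    the last coefficient is at most \<open>N / d\<close> and the others sum to at most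
    \<open>(N + N / d * norm (v n)) / c\<close>; \<open>K\<close> is the total divided by
    \<open>N\<close>.\<close>
  define K where "K = (1 + norm (v n) / d) / c + 1 / d"
  have K: "K > 0"
    using c d by (simp add: K_def add_pos_nonneg add_nonneg_pos)
  have main: "(\<Sum>i<Suc n. cmod (a i)) \<le> K * norm ((\<Sum>i<Suc n. a i *\<^sub>C v i) + y)"
    if y: "y \<in> Y" for a y
  proof -
    define N where "N = norm ((\<Sum>i<Suc n. a i *\<^sub>C v i) + y)"
    have "y + (\<Sum>i<n. a i *\<^sub>C v i) \<in> Y + cspan (v ` {..<n})"
      using y unfolding cspan_image_lessThan by (intro set_plus_intro) auto
    from dist[OF this, of "a n"] have "d * cmod (a n) \<le> N"
      by (simp add: N_def algebra_simps)
    then have an: "cmod (a n) \<le> N / d"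
      using d by (simp add: field_simps)
    have "c * (\<Sum>i<n. cmod (a i)) \<le> norm (((\<Sum>i<Suc n. a i *\<^sub>C v i) + y) - a n *\<^sub>C v n)"
      using bound[OF y, of a] by (simp add: algebra_simps)
    also have "\<dots> \<le> N + cmod (a n) * norm (v n)"
      unfolding N_def by (rule order_trans[OF norm_triangle_ineq4]) (simp add: norm_scaleC)
    also have "\<dots> \<le> N + N / d * norm (v n)"
      using mult_right_mono[OF an norm_ge_zero[of "v n"]] by simp
    finally have "(\<Sum>i<n. cmod (a i)) \<le> (N + N / d * norm (v n)) / c"
      using c by (simp add: field_simps)
    with an show ?thesis
      unfolding N_def[symmetric] K_def by (simp add: field_simps)
  qed
  show "indep_mod Y (Suc n) v"
    unfolding indep_mod_def
  proof (intro exI[of _ "1 / K"] conjI allI ballI)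
    show "1 / K > 0" using K by simp
    show "1 / K * (\<Sum>i<Suc n. cmod (a i)) \<le> norm ((\<Sum>i<Suc n. a i *\<^sub>C v i) + y)"
      if "y \<in> Y" for a y
      using main[OF that, of a] K by (simp add: field_simps)
  qed
qed

text \<open>Moving each vector by at most \<open>c / 2\<close> changes a combination by at most half
  of its lower bound, so the constant \<open>c / 2\<close> survives.\<close>

lemma indep_mod_perturb:
  assumes "indep_mod Y n v"
  obtains e where "e > 0" "\<And>w. (\<And>i. i < n \<Longrightarrow> norm (w i - v i) \<le> e) \<Longrightarrow> indep_mod Y n w"
proof -
  obtain c where c: "c > 0" and
    bound: "\<And>a y. y \<in> Y \<Longrightarrow>
      c * (\<Sum>i<n. cmod (a i)) \<le> norm ((\<Sum>i<n. a i *\<^sub>C v i) + y)"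
    using assms unfolding indep_mod_def by blast
  have "indep_mod Y n w" if w: "\<And>i. i < n \<Longrightarrow> norm (w i - v i) \<le> c / 2" for w
    unfolding indep_mod_def
  proof (intro exI[of _ "c / 2"] conjI allI ballI)
    fix a y assume y: "y \<in> Y"
    have "norm (\<Sum>i<n. a i *\<^sub>C (w i - v i)) \<le> (\<Sum>i<n. cmod (a i) * (c / 2))"
    proof (rule sum_norm_le)
      show "norm (a i *\<^sub>C (w i - v i)) \<le> cmod (a i) * (c / 2)" if "i \<in> {..<n}" for i
        unfolding norm_scaleC using w that by (intro mult_left_mono) auto
    qed
    also have "\<dots> = c / 2 * (\<Sum>i<n. cmod (a i))"
      by (simp add: sum_distrib_left mult.commute)
    finally have diff: "norm (\<Sum>i<n. a i *\<^sub>C (w i - v i)) \<le> c / 2 * (\<Sum>i<n. cmod (a i))" .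
    have "(\<Sum>i<n. a i *\<^sub>C v i) + y
        = ((\<Sum>i<n. a i *\<^sub>C w i) + y) - (\<Sum>i<n. a i *\<^sub>C (w i - v i))"
      by (simp add: complex_vector.scale_right_diff_distrib sum_subtractf)
    then have "norm ((\<Sum>i<n. a i *\<^sub>C v i) + y)
        \<le> norm ((\<Sum>i<n. a i *\<^sub>C w i) + y) + norm (\<Sum>i<n. a i *\<^sub>C (w i - v i))"
      using norm_triangle_ineq4 by metis
    with bound[OF y, of a] diff
    show "c / 2 * (\<Sum>i<n. cmod (a i)) \<le> norm ((\<Sum>i<n. a i *\<^sub>C w i) + y)"
      by (simp add: field_simps)
  qed (use c in simp)
  with c that[of "c / 2"] show thesis by simp
qed

text \<open>Replacing each \<open>v i\<close> by a representative \<open>m i\<close> in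
  \<open>cspan B\<close> changes it only by an element of \<open>Y\<close>. The \<open>m i\<close>
  therefore inherit the lower bound, are independent in the ordinary sense, and number at most
  \<open>card B\<close>.\<close>

lemma indep_mod_le_card:
  assumes Y: "closed_csubspace Y" and "finite B"
    and indep: "indep_mod Y n v" and v: "\<And>i. i < n \<Longrightarrow> v i \<in> Y + cspan B"
  shows "n \<le> card B"
proof -
  have "\<forall>i. \<exists>m. i < n \<longrightarrow> m \<in> cspan B \<and> v i - m \<in> Y"
    using v by (fastforce simp: set_plus_def)
  then obtain m where m: "\<And>i. i < n \<Longrightarrow> m i \<in> cspan B" "\<And>i. i < n \<Longrightarrow> v i - m i \<in> Y"
    by metis
  have sub: "csubspace Y"
    using Y by (simp add: closed_csubspace_def)
  obtain c where c: "c > 0" and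
    bound: "\<And>a y. y \<in> Y \<Longrightarrow>
      c * (\<Sum>i<n. cmod (a i)) \<le> norm ((\<Sum>i<n. a i *\<^sub>C v i) + y)"
    using indep unfolding indep_mod_def by blast
  have "indep_mod {0} n m"
    unfolding indep_mod_def
  proof (intro exI[of _ c] conjI allI ballI)
    fix a and y :: 'a assume "y \<in> {0}"
    have "- (\<Sum>i<n. a i *\<^sub>C (v i - m i)) \<in> Y"
      using m(2) by (intro complex_vector.subspace_neg[OF sub] complex_vector.subspace_sum[OF sub]
          complex_vector.subspace_scale[OF sub]) auto
    from bound[OF this, of a] \<open>y \<in> {0}\<close>
    show "c * (\<Sum>i<n. cmod (a i)) \<le> norm ((\<Sum>i<n. a i *\<^sub>C m i) + y)"
      by (simp add: complex_vector.scale_right_diff_distrib sum_subtractf)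
  qed (rule c)
  \<comment> \<open>With \<open>{0}\<close> in place of \<open>Y\<close>,
    \<open>indep_mod_Suc\<close> says that each vector avoids the span of its predecessors; this
    gives both independence and distinctness.\<close>
  then have "complex_vector.independent (m ` {..<n}) \<and> card (m ` {..<n}) = n"
  proof (induction n)
    case (Suc n)
    then have ih: "complex_vector.independent (m ` {..<n})" "card (m ` {..<n}) = n"
      and new: "m n \<notin> cspan (m ` {..<n})"
      using indep_mod_Suc[OF closed_csubspace_zero, of n m] by auto
    from new have "m n \<notin> m ` {..<n}"
      using complex_vector.span_base[of "m n" "m ` {..<n}"] by fast
    with ih new show ?case
      by (simp add: lessThan_Suc complex_vector.independent_insertI)
  qed (simp add: complex_vector.independent_empty)
  moreover have "m ` {..<n} \<subseteq> cspan B"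
    using m(1) by auto
  ultimately show ?thesis
    using complex_vector.independent_span_bound[OF \<open>finite B\<close>, of "m ` {..<n}"] by simp
qed

section \<open>Rank of the induced maps and Baire category\<close>

text \<open>The operators \<open>T\<close> for which the induced map \<open>Y \<rightarrow> X / Y\<close> has rank at least \<open>n\<close>.\<close>

definition rank_mod_ge :: "'a::complex_banach set \<Rightarrow> nat \<Rightarrow> ('a \<Rightarrow>\<^sub>L 'a) set" where
  "rank_mod_ge Y n = {T. \<exists>y. (\<forall>i<n. y i \<in> Y) \<and> indep_mod Y n (\<lambda>i. blinfun_apply T (y i))}"

text \<open>The vectors \<open>y i\<close> stay fixed while the operator varies: finitely many of
  them have bounded norms, so one radius in operator norm keeps all images close.\<close>

lemma indep_mod_operator_perturb:
  assumes "indep_mod Y n (\<lambda>i. blinfun_apply T (y i))"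
  obtains e where "e > 0" "\<And>S. dist S T < e \<Longrightarrow> indep_mod Y n (\<lambda>i. blinfun_apply S (y i))"
proof -
  obtain e where e: "e > 0"
    "\<And>w. (\<And>i. i < n \<Longrightarrow> norm (w i - blinfun_apply T (y i)) \<le> e) \<Longrightarrow> indep_mod Y n w"
    using indep_mod_perturb[OF assms] by blast
  \<comment> \<open>The summand 1 keeps \<open>K\<close> positive even when every \<open>y i\<close>
    is 0 or \<open>n = 0\<close>.\<close>
  define K where "K = 1 + (\<Sum>i<n. norm (y i))"
  have K: "K > 0"
    by (simp add: K_def add_pos_nonneg sum_nonneg)
  have "indep_mod Y n (\<lambda>i. blinfun_apply S (y i))" if S: "dist S T < e / K" for S
  proof (rule e(2))
    fix i assume "i < n"
    then have "norm (y i) \<le> (\<Sum>i<n. norm (y i))"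
      by (intro member_le_sum) auto
    then have "norm (y i) \<le> K"
      by (simp add: K_def)
    have "norm (blinfun_apply S (y i) - blinfun_apply T (y i)) \<le> norm (S - T) * norm (y i)"
      by (metis blinfun.diff_left norm_blinfun)
    also have "\<dots> \<le> e / K * K"
      using S \<open>norm (y i) \<le> K\<close> e(1) K by (intro mult_mono) (auto simp: dist_norm)
    finally show "norm (blinfun_apply S (y i) - blinfun_apply T (y i)) \<le> e"
      using K by simp
  qed
  with e(1) K that[of "e / K"] show thesis by simp
qed

lemma open_rank_mod_ge: "open (rank_mod_ge Y n)"
  unfolding open_dist
proof
  fix T assume "T \<in> rank_mod_ge Y n"
  then obtain y where y: "\<forall>i<n. y i \<in> Y" "indep_mod Y n (\<lambda>i. blinfun_apply T (y i))"
    by (auto simp: rank_mod_ge_def)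
  from y(2) obtain e where
    "e > 0" "\<And>S. dist S T < e \<Longrightarrow> indep_mod Y n (\<lambda>i. blinfun_apply S (y i))"
    using indep_mod_operator_perturb by blast
  with y(1) show "\<exists>e>0. \<forall>S. dist S T < e \<longrightarrow> S \<in> rank_mod_ge Y n"
    unfolding rank_mod_ge_def by blast
qed

text \<open>No operator in \<open>\<A>\<close> has rank at least \<open>n\<close> for every
  \<open>n\<close>. The relatively open sets of rank at least \<open>n\<close> thus have empty
  intersection, so by Baire's theorem in the completely metrizable \<open>\<A>\<close> one of them
  is not dense and misses a nonempty relatively open set.\<close>

lemma rank_mod_locally_bounded:
  fixes \<A> :: "('a::complex_banach \<Rightarrow>\<^sub>L 'a) set"
  assumes Y: "closed_csubspace Y" and \<A>: "closed \<A>" "\<A> \<noteq> {}"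
    and fin: "\<And>T. T \<in> \<A> \<Longrightarrow> \<exists>M. finite_cdim M \<and> blinfun_apply T ` Y \<subseteq> Y + M"
  obtains U n where "open U" "\<A> \<inter> U \<inter> rank_mod_ge Y n \<noteq> {}"
    "\<A> \<inter> U \<inter> rank_mod_ge Y (Suc n) = {}"
proof -
  have notin: "\<exists>n. T \<notin> rank_mod_ge Y n" if T: "T \<in> \<A>" for T
  proof -
    obtain B where "finite B" and B: "blinfun_apply T ` Y \<subseteq> Y + cspan B"
      using fin[OF T] unfolding finite_cdim_def by (meson order_refl set_plus_mono2 subset_trans)
    have "T \<notin> rank_mod_ge Y (Suc (card B))"
    proof
      assume "T \<in> rank_mod_ge Y (Suc (card B))"
      then obtain y where "\<forall>i<Suc (card B). y i \<in> Y"
        "indep_mod Y (Suc (card B)) (\<lambda>i. blinfun_apply T (y i))"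
        by (auto simp: rank_mod_ge_def)
      then have "Suc (card B) \<le> card B"
        using B by (intro indep_mod_le_card[OF Y \<open>finite B\<close>]) auto
      then show False by simp
    qed
    then show ?thesis ..
  qed
  let ?X = "top_of_set \<A>"
  have "\<exists>n. ?X closure_of (\<A> \<inter> rank_mod_ge Y n) \<noteq> \<A>"
  proof (rule ccontr)
    assume "\<not> ?thesis"
    then have "?X closure_of (\<Inter>n. \<A> \<inter> rank_mod_ge Y n) = topspace ?X"
      using \<A>(1)
      by (intro Baire_category disjI1 completely_metrizable_space_closedin[
            OF completely_metrizable_space_euclidean])
        (auto intro: openin_open_Int open_rank_mod_ge)
    moreover have "(\<Inter>n. \<A> \<inter> rank_mod_ge Y n) = {}"
      using notin by auto
    ultimately show False
      using \<A>(2) by simp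
  qed
  then obtain N T where "T \<in> \<A>" "T \<notin> ?X closure_of (\<A> \<inter> rank_mod_ge Y N)"
    by (metis closure_of_subset_topspace subsetI subset_antisym topspace_euclidean_subtopology)
  then obtain U where "open U" "T \<in> U" and empty: "\<A> \<inter> U \<inter> rank_mod_ge Y N = {}"
    by (auto simp: in_closure_of openin_open)
  define N0 where "N0 = (LEAST n. \<A> \<inter> U \<inter> rank_mod_ge Y n = {})"
  have N0: "\<A> \<inter> U \<inter> rank_mod_ge Y N0 = {}"
    unfolding N0_def using empty by (rule LeastI)
  \<comment> \<open>Rank at least 0 always holds, so the least failing value \<open>N0\<close> is a
    successor, and its predecessor is the maximal rank on \<open>U\<close>.\<close>
  have "T \<in> rank_mod_ge Y 0"
    by (simp add: rank_mod_ge_def indep_mod_0)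
  with N0 \<open>T \<in> \<A>\<close> \<open>T \<in> U\<close> obtain n where n: "N0 = Suc n"
    by (cases N0) auto
  then have "\<A> \<inter> U \<inter> rank_mod_ge Y n \<noteq> {}"
    using not_less_Least[of n "\<lambda>n. \<A> \<inter> U \<inter> rank_mod_ge Y n = {}"] by (simp add: N0_def)
  with N0 n \<open>open U\<close> that show thesis by blast
qed

section \<open>A finite-dimensional defect common to all operators\<close>

lemma finite_defect_uniform:
  fixes \<A> :: "('a::complex_banach \<Rightarrow>\<^sub>L 'a) set"
  assumes Y: "closed_csubspace Y" and \<A>: "closed_csubspace \<A>" "\<A> \<subseteq> complex_operators"
    and fin: "\<And>T. T \<in> \<A> \<Longrightarrow> \<exists>M. finite_cdim M \<and> blinfun_apply T ` Y \<subseteq> Y + M"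
  obtains V B C where "csubspace V" "V \<subseteq> Y" "finite B" "B \<subseteq> Y" "finite C"
    "Y \<subseteq> V + cspan B" "\<forall>T\<in>\<A>. blinfun_apply T ` V \<subseteq> Y + cspan C"
proof -
  have subA: "csubspace \<A>" and clA: "closed \<A>" and neA: "\<A> \<noteq> {}"
    using \<A>(1) complex_vector.subspace_0 by (auto simp: closed_csubspace_def)
  have sub: "csubspace Y"
    using Y by (simp add: closed_csubspace_def)
  obtain U n where "open U" and ne: "\<A> \<inter> U \<inter> rank_mod_ge Y n \<noteq> {}"
    and empty: "\<A> \<inter> U \<inter> rank_mod_ge Y (Suc n) = {}"
    using rank_mod_locally_bounded[OF Y clA neA fin] .
  from ne obtain T\<^sub>0 y where T\<^sub>0: "T\<^sub>0 \<in> \<A>" "T\<^sub>0 \<in> U" and y: "\<forall>i<n. y i \<in> Y"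
    and indep: "indep_mod Y n (\<lambda>i. blinfun_apply T\<^sub>0 (y i))"
    by (auto simp: rank_mod_ge_def)
  \<comment> \<open>Otherwise \<open>z\<close> could be appended to the \<open>y i\<close>, giving
    rank \<open>Suc n\<close> inside \<open>U\<close>. The claim covers every such \<open>T\<close>,
    because it is applied to \<open>T\<^sub>0\<close> and later to a perturbation of it.\<close>
  have max: "blinfun_apply T z \<in> Y + cspan ((\<lambda>i. blinfun_apply T (y i)) ` {..<n})"
    if T: "T \<in> \<A>" "T \<in> U" "indep_mod Y n (\<lambda>i. blinfun_apply T (y i))" and z: "z \<in> Y" for T z
  proof (rule ccontr)
    assume *: "\<not> ?thesis"
    let ?y = "y(n := z)"
    have "indep_mod Y n (\<lambda>i. blinfun_apply T (?y i))"
      using T(3) by (subst indep_mod_cong[where w = "\<lambda>i. blinfun_apply T (y i)"]) auto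
    moreover have "(\<lambda>i. blinfun_apply T (?y i)) ` {..<n} = (\<lambda>i. blinfun_apply T (y i)) ` {..<n}"
      by (rule image_cong) auto
    ultimately have "indep_mod Y (Suc n) (\<lambda>i. blinfun_apply T (?y i))"
      using * by (simp add: indep_mod_Suc[OF Y])
    moreover have "\<forall>i<Suc n. ?y i \<in> Y"
      using y z by (simp add: less_Suc_eq)
    ultimately have "T \<in> rank_mod_ge Y (Suc n)"
      unfolding rank_mod_ge_def by blast
    with T empty show False by blast
  qed
  define V where "V = Y \<inter> {x. blinfun_apply T\<^sub>0 x \<in> Y}"
  define C where "C = (\<lambda>i. blinfun_apply T\<^sub>0 (y i)) ` {..<n}"
  have T\<^sub>0c: "T\<^sub>0 \<in> complex_operators"
    using T\<^sub>0(1) \<A>(2) by blast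
  show thesis
  proof (rule that)
    show "csubspace V"
      unfolding V_def by (intro complex_vector.subspace_inter sub csubspace_vimage T\<^sub>0c)
    show "V \<subseteq> Y" "finite (y ` {..<n})" "y ` {..<n} \<subseteq> Y" "finite C"
      using y by (auto simp: V_def C_def)
    show "Y \<subseteq> V + cspan (y ` {..<n})"
    proof
      fix z assume z: "z \<in> Y"
      from max[OF T\<^sub>0 indep z] obtain x a
        where x: "x \<in> Y" "blinfun_apply T\<^sub>0 z = x + (\<Sum>i<n. a i *\<^sub>C blinfun_apply T\<^sub>0 (y i))"
        by (auto simp: set_plus_def cspan_image_lessThan)
      \<comment> \<open>The combination of the \<open>y i\<close> with the same image as
        \<open>z\<close> modulo \<open>Y\<close>; subtracting it moves \<open>z\<close> into the
        kernel \<open>V\<close>.\<close>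
      let ?s = "\<Sum>i<n. a i *\<^sub>C y i"
      have "blinfun_apply T\<^sub>0 (z - ?s) = x"
        using x(2) T\<^sub>0c by (simp add: blinfun.diff_right blinfun.sum_right complex_operators_def)
      moreover have "z - ?s \<in> Y"
        using y z by (intro complex_vector.subspace_diff[OF sub] complex_vector.subspace_sum[OF sub]
            complex_vector.subspace_scale[OF sub]) auto
      ultimately have "z - ?s \<in> V"
        using x(1) by (simp add: V_def)
      moreover have "?s \<in> cspan (y ` {..<n})"
        by (auto simp: cspan_image_lessThan)
      ultimately have "(z - ?s) + ?s \<in> V + cspan (y ` {..<n})"
        by (rule set_plus_intro)
      then show "z \<in> V + cspan (y ` {..<n})" by simp
    qed
    show "\<forall>T\<in>\<A>. blinfun_apply T ` V \<subseteq> Y + cspan C"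
    proof (rule ccontr)
      assume "\<not> ?thesis"
      then obtain T z where T: "T \<in> \<A>" and z: "z \<in> Y" "blinfun_apply T\<^sub>0 z \<in> Y" "blinfun_apply T z \<notin> Y + cspan C"
        by (auto simp: V_def)
      \<comment> \<open>Only the first \<open>n\<close> entries follow the operator
        \<open>S\<close>; the last stays \<open>T z\<close>. Using \<open>S r z\<close> instead
        would fail: as \<open>T\<^sub>0 z\<close> lies in \<open>Y\<close>, it equals
        \<open>r *\<^sub>R T z\<close> modulo \<open>Y\<close>, which degenerates as
        \<open>r\<close> tends to 0.\<close>
      define w where "w S = (\<lambda>i. if i < n then blinfun_apply S (y i) else blinfun_apply T z)" for S
      have w_less: "indep_mod Y n (w S) \<longleftrightarrow> indep_mod Y n (\<lambda>i. blinfun_apply S (y i))" for S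
        by (rule indep_mod_cong) (simp add: w_def)
      have w_img: "w S ` {..<n} = (\<lambda>i. blinfun_apply S (y i)) ` {..<n}" for S
        by (rule image_cong) (simp_all add: w_def)
      have "indep_mod Y (Suc n) (w T\<^sub>0)"
        unfolding indep_mod_Suc[OF Y] w_less w_img using indep z(3) by (simp add: w_def C_def)
      then obtain e where e: "e > 0"
        "\<And>v. (\<And>i. i < Suc n \<Longrightarrow> norm (v i - w T\<^sub>0 i) \<le> e) \<Longrightarrow> indep_mod Y (Suc n) v"
        using indep_mod_perturb by blast
      define S where "S r = T\<^sub>0 + r *\<^sub>R T" for r :: real
      have "(S \<longlongrightarrow> T\<^sub>0) (at 0)"
        unfolding S_def by (auto intro!: tendsto_eq_intros)
      then have "\<forall>\<^sub>F r in at 0. S r \<in> U"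
        using \<open>open U\<close> T\<^sub>0(2) by (rule topological_tendstoD)
      moreover have "\<forall>\<^sub>F r in at 0. \<forall>i\<in>{..<Suc n}. dist (w (S r) i) (w T\<^sub>0 i) < e"
      proof (rule eventually_ball_finite)
        show "\<forall>i\<in>{..<Suc n}. \<forall>\<^sub>F r in at 0. dist (w (S r) i) (w T\<^sub>0 i) < e"
        proof
          fix i
          have "((\<lambda>r. w (S r) i) \<longlongrightarrow> w T\<^sub>0 i) (at 0)"
            unfolding w_def S_def
            by (cases "i < n") (auto simp: blinfun.add_left blinfun.scaleR_left
                intro!: tendsto_eq_intros)
          then show "\<forall>\<^sub>F r in at 0. dist (w (S r) i) (w T\<^sub>0 i) < e"
            using e(1) by (rule tendstoD)
        qed
      qed simp
      moreover have "\<forall>\<^sub>F r in at (0::real). r \<noteq> 0"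
        by (rule eventually_neq_at_within)
      ultimately have "\<forall>\<^sub>F r in at 0. S r \<in> U \<and>
          (\<forall>i\<in>{..<Suc n}. dist (w (S r) i) (w T\<^sub>0 i) < e) \<and> r \<noteq> 0"
        by eventually_elim blast
      then obtain r where r: "S r \<in> U" "r \<noteq> 0"
        and close: "\<And>i. i < Suc n \<Longrightarrow> dist (w (S r) i) (w T\<^sub>0 i) < e"
        using eventually_happens'[OF at_neq_bot] by (metis (mono_tags, lifting) lessThan_iff)
      have "indep_mod Y (Suc n) (w (S r))"
        using close by (intro e(2)) (simp add: dist_norm less_imp_le)
      then have ind: "indep_mod Y n (\<lambda>i. blinfun_apply (S r) (y i))"
        and Tz: "blinfun_apply T z \<notin> Y + cspan ((\<lambda>i. blinfun_apply (S r) (y i)) ` {..<n})"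
        unfolding indep_mod_Suc[OF Y] w_less w_img by (simp_all add: w_def)
      let ?W = "Y + cspan ((\<lambda>i. blinfun_apply (S r) (y i)) ` {..<n})"
      have W: "subspace ?W"
        by (intro csubspace_imp_subspace csubspace_set_plus sub complex_vector.subspace_span)
      have "S r \<in> \<A>"
        unfolding S_def using T\<^sub>0(1) T csubspace_imp_subspace[OF subA]
        by (intro subspace_add subspace_scale)
      \<comment> \<open>Maximality puts \<open>S r z\<close> in \<open>?W\<close>, and
        \<open>T\<^sub>0 z\<close> is there already as an element of \<open>Y\<close>. Their
        difference is \<open>r *\<^sub>R T z\<close>, so dividing by \<open>r\<close> contradicts
        \<open>Tz\<close>.\<close>
      then have "blinfun_apply (S r) z \<in> ?W"
        using r(1) ind z(1) by (rule max)
      moreover have "blinfun_apply T\<^sub>0 z \<in> ?W"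
        using set_plus_intro[OF z(2) complex_vector.span_zero] by simp
      ultimately have "inverse r *\<^sub>R (blinfun_apply (S r) z - blinfun_apply T\<^sub>0 z) \<in> ?W"
        by (intro subspace_scale[OF W] subspace_diff[OF W])
      with Tz r(2) show False
        by (simp add: S_def blinfun.add_left blinfun.scaleR_left)
    qed
  qed
qed

section \<open>Construction of the invariant half-space\<close>

theorem theorem3p3:
  fixes \<A> :: "('a::complex_banach \<Rightarrow>\<^sub>L 'a) set" and Y :: "'a set"
  assumes "closed_operator_algebra \<A>"
    and "half_space Y"
    and "topologically_complemented Y"
    and "\<forall>T\<in>\<A>. \<exists>M. closed_csubspace M \<and> finite_cdim M \<and> blinfun_apply T ` Y \<subseteq> Y + M"
  shows "\<exists>L. half_space L \<and> invariant_under \<A> L \<and>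
    (\<exists>F. closed_csubspace F \<and> finite_cdim F \<and> L \<subseteq> Y + F \<and> finite_cdim_quotient (Y + F) L)"
proof -
  have \<A>: "closed_csubspace \<A>" "\<A> \<subseteq> complex_operators"
    and mult: "\<And>S T. S \<in> \<A> \<Longrightarrow> T \<in> \<A> \<Longrightarrow> S o\<^sub>L T \<in> \<A>"
    using assms(1) by (auto simp: closed_operator_algebra_def)
  have Y: "closed_csubspace Y" and infY: "\<not> finite_cdim Y"
    and coinfY: "\<not> finite_cdim_quotient UNIV Y"
    using assms(2) by (auto simp: half_space_def)
  have sub: "csubspace Y"
    using Y by (simp add: closed_csubspace_def)
  have fin: "\<exists>M. finite_cdim M \<and> blinfun_apply T ` Y \<subseteq> Y + M" if "T \<in> \<A>" for T
    using assms(4) that by blast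
  obtain V B C where V: "csubspace V" "V \<subseteq> Y" and B: "finite B" "B \<subseteq> Y"
    and C: "finite C" and YV: "Y \<subseteq> V + cspan B"
    and TV: "\<forall>T\<in>\<A>. blinfun_apply T ` V \<subseteq> Y + cspan C"
    using finite_defect_uniform[OF Y \<A> fin] .
  \<comment> \<open>The closed span is taken as an intersection, so that upper bounds on
    \<open>L\<close> follow by exhibiting members of \<open>\<W>\<close>. The condition on
    \<open>V\<close> itself is separate because \<open>\<A>\<close> may lack the identity.\<close>
  define \<W> where "\<W> = {W. closed_csubspace W \<and> V \<subseteq> W \<and> (\<forall>T\<in>\<A>. blinfun_apply T ` V \<subseteq> W)}"
  define L where "L = \<Inter>\<W>"
  have "Y \<subseteq> Y + cspan C"
    using complex_vector.span_zero by (force simp: set_plus_def)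
  with V(2) TV have "Y + cspan C \<in> \<W>"
    using closed_csubspace_plus_cspan[OF C Y] by (auto simp: \<W>_def)
  then have LF: "L \<subseteq> Y + cspan C"
    by (auto simp: L_def)
  have VL: "V \<subseteq> L" and AVL: "\<And>T. T \<in> \<A> \<Longrightarrow> blinfun_apply T ` V \<subseteq> L"
    by (auto simp: L_def \<W>_def)
  have subL: "csubspace L"
    unfolding L_def by (rule complex_vector.subspace_Inter) (simp add: \<W>_def closed_csubspace_def)
  have "closed L"
    unfolding L_def by (rule closed_Inter) (simp add: \<W>_def closed_csubspace_def)
  with subL have L: "closed_csubspace L"
    by (simp add: closed_csubspace_def)
  have inv: "invariant_under \<A> L"
    unfolding invariant_under_def
  proof
    fix T assume T: "T \<in> \<A>"
    \<comment> \<open>Invariance under \<open>T\<close> means that \<open>L\<close> lies in this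
      preimage, so membership of the preimage in \<open>\<W>\<close> suffices. For \<open>S\<close>
      in \<open>\<A>\<close> the product of \<open>T\<close> and \<open>S\<close> is again in
      \<open>\<A>\<close> and maps \<open>V\<close> into \<open>L\<close>.\<close>
    let ?W = "{x. blinfun_apply T x \<in> L}"
    have "closed (blinfun_apply T -` L)"
      using \<open>closed L\<close> by (intro closed_vimage) (auto intro: continuous_intros)
    then have "closed_csubspace ?W"
      using csubspace_vimage[OF _ subL, of T] T \<A>(2) by (auto simp: closed_csubspace_def vimage_def)
    moreover have "blinfun_apply S ` V \<subseteq> ?W" if "S \<in> \<A>" for S
      using AVL[OF mult[OF T that]] by auto
    ultimately have "?W \<in> \<W>"
      using AVL[OF T] by (auto simp: \<W>_def)
    then show "blinfun_apply T ` L \<subseteq> L"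
      by (auto simp: L_def)
  qed
  \<comment> \<open>\<open>Y\<close> lies in \<open>L + cspan B\<close>, so a finite-dimensional
    \<open>L\<close> would make \<open>Y\<close> finite-dimensional.\<close>
  have "\<not> finite_cdim L"
  proof
    assume "finite_cdim L"
    then obtain D where "finite D" "L \<subseteq> cspan D"
      by (auto simp: finite_cdim_def)
    then have "Y \<subseteq> cspan (D \<union> B)"
      using YV VL set_plus_mono2[of V "cspan D" "cspan B" "cspan B"] by (auto simp: cspan_Un)
    with \<open>finite D\<close> B(1) infY show False
      using finite_cdim_subset by blast
  qed
  \<comment> \<open>Since \<open>L\<close> lies in \<open>Y + cspan C\<close>, vectors spanning the
    space modulo \<open>L\<close> span it modulo \<open>Y\<close> once \<open>C\<close> is
    added.\<close>
  moreover have "\<not> finite_cdim_quotient UNIV L"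
  proof
    assume "finite_cdim_quotient UNIV L"
    then obtain D where "finite D" "UNIV \<subseteq> L + cspan D"
      by (auto simp: finite_cdim_quotient_iff[OF subL])
    moreover have "L + cspan D \<subseteq> Y + cspan (C \<union> D)"
      using set_plus_mono2[OF LF order_refl] by (simp add: cspan_Un add.assoc)
    ultimately show False
      using C coinfY unfolding finite_cdim_quotient_iff[OF sub]
      by (metis finite_UnI subset_UNIV subset_trans)
  qed
  moreover have "finite_cdim_quotient (Y + cspan C) L"
    unfolding finite_cdim_quotient_iff[OF subL]
  proof (intro exI conjI)
    \<comment> \<open>\<open>B\<close> generates \<open>Y\<close> modulo \<open>V\<close>, hence
      modulo the larger \<open>L\<close>; \<open>C\<close> accounts for the added summand.\<close>
    show "finite (B \<union> C)"
      using B C by simp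
    have "C \<subseteq> Y + cspan C"
      using set_plus_intro[OF complex_vector.subspace_0[OF sub] complex_vector.span_base] by force
    with B \<open>Y \<subseteq> Y + cspan C\<close> show "B \<union> C \<subseteq> Y + cspan C"
      by blast
    have "Y \<subseteq> L + cspan B"
      using YV set_plus_mono2[OF VL order_refl] by blast
    then show "Y + cspan C \<subseteq> L + cspan (B \<union> C)"
      using set_plus_mono2[OF _ order_refl, of Y "L + cspan B" "cspan C"]
      by (simp add: cspan_Un add.assoc)
  qed
  ultimately show ?thesis
    using L inv LF closed_csubspace_cspan[OF C] finite_cdim_cspan[OF C]
    unfolding half_space_def by blast
qed

end
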